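(* Let $m,n\geq 1$ be integers and let $\mathbf{k}=(k_1,\ldots,k_n)$ be an $n$-tuple of real numbers with $k_j>0$ for $1\leq j\leq n$ and $\sum_{j=1}^n k_j=1$. Then for every matrix $\mathcal{L}\in \mathbf{Bad}(\mathbf{k},n,m)$ the set $\mathbf{Bad}_{\mathcal{L}}(\mathbf{k},n,m)$ is $1/2$ winning.
   Context: Notation: $\|x\|$ is the distance from the real number $x$ to the nearest integer, and $|\mathbf{q}|=\max_i|q_i|$ is the supremum norm. For a real $n\times m$ matrix $\mathcal{L}=(x_{ji})_{1\leq j\leq n,\,1\leq i\leq m}$ put $L_j(\mathbf{q})=\sum_{i=1}^m q_i x_{ji}$ for $\mathbf q=(q_1,\dots,q_m)$ and $1\leq j\leq n$. $\mathbf{Bad}(\mathbf{k},n,m)$ is the set of all real $n\times m$ matrices $\mathcal{L}$ such that $$\inf_{\mathbf{q}\in\mathbb{Z}^m\setminus\{\mathbf{0}\}}\ \max_{1\leq j\leq n}\left(|\mathbf{q}|^{mk_j}\,\|L_j(\mathbf{q})\|\right)>0 .$$ For a real $n\times m$ matrix $\mathcal{L}$, $$\mathbf{Bad}_{\mathcal{L}}(\mathbf{k},n,m)=\left\{\boldsymbol\alpha=(\alpha_1,\dots,\alpha_n)\in[0,1)^n:\ \inf_{\mathbf{q}\in\mathbb{Z}^m\setminus\{\mathbf{0}\}}\ \max_{1\leq j\leq n}\left(|\mathbf{q}|^{mk_j}\,\|L_j(\mathbf{q})-\alpha_j\|\right)>0\right\}.$$ Winning sets (in the sense of Schmidt): for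 $a,b\in(0,1)$ and $S\subseteq\mathbb{R}^n$, the $(a,b)$-game is played by Bob and Alice. Bob chooses a closed Euclidean ball $B_1\subset\mathbb{R}^n$ of positive radius; Alice chooses a closed ball $A_1\subset B_1$ of radius $a$ times that of $B_1$; Bob chooses a closed ball $B_2\subset A_1$ of radius $b$ times that of $A_1$; and so on. Alice wins if the unique point of $\bigcap_r B_r$ lies in $S$. The set $S$ is $(a,b)$-winning if Alice has a winning strategy, and $S$ is $a$ winning if it is $(a,b)$-winning for every $b\in(0,1)$. A subset of $[0,1)^n$ defined by a condition invariant under $\mathbb{Z}^n$-translations of $\boldsymbol\alpha$ (as here) is regarded modulo $\mathbb{Z}^n$: it is called $a$ winning if the set of all $\boldsymbol\alpha\in\mathbb{R}^n$ satisfying the same condition is $a$ winning. *)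

theory Defs
  imports "HOL-Analysis.Analysis"
begin

definition int_lattice :: "(real ^ 'd) set"
  where "int_lattice = {q. \<forall>i. q $ i \<in> \<int>}"

definition dist_int :: "real \<Rightarrow> real"
  where "dist_int x = infdist x \<int>"

text \<open>The number m of columns is \<open>CARD('m)\<close>, and \<open>L_j(q)\<close> is the \<open>j\<close>-th coordinate of
  \<open>L *v q\<close>. The supremum norm is the library's \<^const>\<open>infnorm\<close>; it is at least 1 on non-zero
  integer vectors, so \<open>powr\<close> is used on positive bases only. The infimum is over a non-empty set
  of non-negative reals.\<close>

definition Bad :: "real ^ 'n \<Rightarrow> (real ^ 'm ^ 'n) set"
  where "Bad k = {L. 0 < (INF q \<in> int_lattice - {0}.
           MAX j. infnorm q powr (real CARD('m) * k $ j) * dist_int ((L *v q) $ j))}"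

definition inhom_bad :: "real ^ 'n \<Rightarrow> real ^ 'm ^ 'n \<Rightarrow> real ^ 'n \<Rightarrow> bool"
  where "inhom_bad k L \<alpha> \<longleftrightarrow> 0 < (INF q \<in> int_lattice - {0}.
           MAX j. infnorm q powr (real CARD('m) * k $ j) * dist_int ((L *v q) $ j - \<alpha> $ j))"

definition Bad_inhom :: "real ^ 'n \<Rightarrow> real ^ 'm ^ 'n \<Rightarrow> (real ^ 'n) set"
  where "Bad_inhom k L = {\<alpha>. (\<forall>j. \<alpha> $ j \<in> {0..<1}) \<and> inhom_bad k L \<alpha>}"

text \<open>A move in Schmidt's game is a closed ball, recorded as its centre and radius. In a
  non-trivial Euclidean space a closed ball of positive radius determines both.\<close>

type_synonym 'a move = "'a \<times> real"

definition move_ball :: "'a::euclidean_space move \<Rightarrow> 'a set"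
  where "move_ball P = cball (fst P) (snd P)"

definition legal_reply :: "real \<Rightarrow> 'a::euclidean_space move \<Rightarrow> 'a move \<Rightarrow> bool"
  where "legal_reply c P Q \<longleftrightarrow> snd Q = c * snd P \<and> move_ball Q \<subseteq> move_ball P"

text \<open>A strategy for Alice maps the non-empty list of all of Bob's moves so far to her next move;
  her own earlier moves are determined by these and the strategy. Bob's moves are
  \<open>B 0, B 1, \<dots>\<close>.\<close>

definition bob_legal ::
    "real \<Rightarrow> ('a::euclidean_space move list \<Rightarrow> 'a move) \<Rightarrow> (nat \<Rightarrow> 'a move) \<Rightarrow> nat \<Rightarrow> bool"
  where "bob_legal b \<sigma> B r \<longleftrightarrow>
    (case r of 0 \<Rightarrow> 0 < snd (B 0)
             | Suc s \<Rightarrow> legal_reply b (\<sigma> (map B [0..<Suc s])) (B (Suc s)))"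

text \<open>A winning strategy must give a legal move after every finite legal play, and win every
  infinite one.\<close>

definition winning_strategy ::
    "real \<Rightarrow> real \<Rightarrow> 'a::euclidean_space set \<Rightarrow> ('a move list \<Rightarrow> 'a move) \<Rightarrow> bool"
  where "winning_strategy a b S \<sigma> \<longleftrightarrow>
    (\<forall>B r. (\<forall>s\<le>r. bob_legal b \<sigma> B s) \<longrightarrow> legal_reply a (B r) (\<sigma> (map B [0..<Suc r]))) \<and>
    (\<forall>B. (\<forall>r. bob_legal b \<sigma> B r) \<longrightarrow> (\<exists>x\<in>S. (\<Inter>r. move_ball (B r)) = {x}))"

definition winning :: "real \<Rightarrow> 'a::euclidean_space set \<Rightarrow> bool"
  where "winning a S \<longleftrightarrow> (\<forall>b\<in>{0<..<1}. \<exists>\<sigma>. winning_strategy a b S \<sigma>)"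

definition winning_mod_int :: "real \<Rightarrow> (real ^ 'n) set \<Rightarrow> bool"
  where "winning_mod_int a S \<longleftrightarrow> winning a {x + z | x z. x \<in> S \<and> z \<in> int_lattice}"

lemma dist_int_add:
  assumes "z \<in> \<int>"
  shows "dist_int (x + z) = dist_int x"
proof -
  have "(\<lambda>a. dist (x + z) a) ` \<int> = (\<lambda>a. dist x a) ` \<int>"
  proof (intro subset_antisym image_subsetI)
    fix a :: real assume "a \<in> \<int>"
    with assms show "dist (x + z) a \<in> dist x ` \<int>"
      by (intro image_eqI[where x = "a - z"]) (auto simp: dist_real_def algebra_simps)
    from \<open>a \<in> \<int>\<close> assms show "dist x a \<in> dist (x + z) ` \<int>"
      by (intro image_eqI[where x = "a + z"]) (auto simp: dist_real_def)
  qed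
  then show ?thesis
    by (simp add: dist_int_def infdist_def)
qed

lemma inhom_bad_add:
  assumes "z \<in> int_lattice"
  shows "inhom_bad k L (\<alpha> + z) = inhom_bad k L \<alpha>"
proof -
  have "dist_int (y - (\<alpha> + z) $ j) = dist_int (y - \<alpha> $ j)" for y j
    using dist_int_add[of "- (z $ j)" "y - \<alpha> $ j"] assms
    by (simp add: int_lattice_def algebra_simps)
  then show ?thesis
    by (simp add: inhom_bad_def)
qed

text \<open>Hence for these sets winning modulo \<open>\<int>\<^sup>n\<close> refers to the same condition imposed on all of
  \<open>\<real>\<^sup>n\<close>.\<close>

lemma Bad_inhom_periodic:
  fixes k :: "real ^ 'n" and L :: "real ^ 'm ^ 'n"
  shows "{x + z | x z. x \<in> Bad_inhom k L \<and> z \<in> int_lattice} = {\<alpha>. inhom_bad k L \<alpha>}"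
proof (intro subset_antisym subsetI)
  fix \<alpha> :: "real ^ 'n" assume "\<alpha> \<in> {x + z | x z. x \<in> Bad_inhom k L \<and> z \<in> int_lattice}"
  then show "\<alpha> \<in> {\<alpha>. inhom_bad k L \<alpha>}"
    by (auto simp: Bad_inhom_def inhom_bad_add)
next
  fix \<alpha> :: "real ^ 'n" assume bad: "\<alpha> \<in> {\<alpha>. inhom_bad k L \<alpha>}"
  define z :: "real ^ 'n" where "z = (\<chi> j. of_int \<lfloor>\<alpha> $ j\<rfloor>)"
  define x where "x = (\<chi> j. frac (\<alpha> $ j))"
  have eq: "\<alpha> = x + z"
    by (simp add: x_def z_def vec_eq_iff frac_def)
  have z: "z \<in> int_lattice"
    by (simp add: z_def int_lattice_def)
  have "inhom_bad k L x"
    using bad inhom_bad_add[OF z, of k L x] unfolding eq by blast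
  then have "x \<in> Bad_inhom k L"
    by (simp add: Bad_inhom_def) (simp add: x_def frac_lt_1)
  with eq z show "\<alpha> \<in> {x + z | x z. x \<in> Bad_inhom k L \<and> z \<in> int_lattice}"
    by blast
qed

corollary winning_mod_int_Bad_inhom_iff:
  "winning_mod_int a (Bad_inhom k L) \<longleftrightarrow> winning a {\<alpha>. inhom_bad k L \<alpha>}"
  by (simp add: winning_mod_int_def Bad_inhom_periodic)

end

theory Submission
  imports Defs
begin

text \<open>A pigeonhole argument transfers bad approximability from \<open>L\<close> to its transpose. Let \<open>k $ j0\<close>
  be the largest weight and \<open>\<kappa> = m k $ j0\<close>. For every large \<open>T\<close> Dirichlet's theorem then gives an
  integer vector \<open>u\<close> with \<open>u $ j\<close> of order at most \<open>T powr (m k $ j)\<close> and \<open>L\<^sup>T u\<close> within \<open>1 / T\<close> of an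
  integer vector, whose component \<open>u $ j0\<close> has the full order \<open>T powr \<kappa>\<close>; so the Euclidean norm
  of \<open>u\<close> is of order \<open>T powr \<kappa>\<close> and can be matched with the radii of the game.
  Since \<open>u \<bullet> \<alpha> = (L\<^sup>T u) \<bullet> q - u \<bullet> (L q - \<alpha>)\<close>, a point \<open>\<alpha>\<close> for which \<open>u \<bullet> \<alpha>\<close> stays
  away from the integers, for \<open>u\<close> from a geometric sequence of scales \<open>T\<close>, satisfies the
  inhomogeneous condition. Alice picks one such \<open>u\<close> for every two of her turns, with norm about
  the reciprocal of Bob's radius, and in both turns moves away from the nearest hyperplane
  \<open>u \<bullet> x \<in> \<int>\<close>.\<close>

section \<open>Distance to the nearest integer, integer vectors, infima of maxima\<close>

lemma dist_int_le: "n \<in> \<int> \<Longrightarrow> dist_int x \<le> \<bar>x - n\<bar>"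
  unfolding dist_int_def using infdist_le[of n \<int> x] by (simp add: dist_real_def)

lemma dist_int_attained:
  obtains n where "n \<in> \<int>" "dist_int x = \<bar>x - n\<bar>"
proof -
  obtain n where "n \<in> \<int>" "infdist x \<int> = dist x n"
    using infdist_attains_inf[of "\<int> :: real set" x] closed_Ints by blast
  then show thesis
    using that by (simp add: dist_int_def dist_real_def)
qed

lemma dist_int_nonneg: "0 \<le> dist_int x"
  by (simp add: dist_int_def infdist_nonneg)

lemma dist_int_eq:
  assumes "n \<in> \<int>" "\<bar>y - n\<bar> < 1/2"
  shows "dist_int y = \<bar>y - n\<bar>"
proof -
  obtain l where l: "l \<in> \<int>" "dist_int y = \<bar>y - l\<bar>" by (rule dist_int_attained)
  have "l = n"
  proof (rule ccontr)
    assume "l \<noteq> n"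
    then have "1 \<le> \<bar>l - n\<bar>"
      using assms l by (intro Ints_nonzero_abs_ge1) auto
    with assms l dist_int_le[OF assms(1), of y] show False by linarith
  qed
  with l show ?thesis by simp
qed

lemma one_le_infnorm:
  fixes q :: "real ^ 'd"
  assumes "q \<in> int_lattice" "q \<noteq> 0"
  shows "1 \<le> infnorm q"
proof -
  obtain i where "q $ i \<noteq> 0" using assms(2) by (auto simp: vec_eq_iff)
  then have "1 \<le> \<bar>q $ i\<bar>"
    using assms(1) by (intro Ints_nonzero_abs_ge1) (auto simp: int_lattice_def)
  also have "\<dots> \<le> infnorm q" by (rule component_le_infnorm_cart)
  finally show ?thesis .
qed

lemma infnorm_less_cart:
  fixes q :: "real ^ 'd"
  assumes "\<And>i. \<bar>q $ i\<bar> < r"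
  shows "infnorm q < r"
  using assms unfolding infnorm_cart by (subst finite_Sup_less_iff) (auto simp: full_SetCompr_eq)

lemma int_lattice_nonzero_ex: "int_lattice - {0 :: real ^ 'd} \<noteq> {}"
proof -
  have "(\<chi> i. 1) \<in> int_lattice - {0 :: real ^ 'd}"
    by (simp add: int_lattice_def vec_eq_iff)
  then show ?thesis by blast
qed

text \<open>Replaces a positive infimum by a single constant \<open>c\<close>, the form in which
  both badness conditions are used below. Nonnegativity supplies the lower bound without which a
  real infimum says nothing.\<close>

lemma INF_MAX_pos_iff:
  fixes f :: "'a \<Rightarrow> 'n::finite \<Rightarrow> real"
  assumes "S \<noteq> {}" and nonneg: "\<And>q j. 0 \<le> f q j"
  shows "0 < (INF q\<in>S. MAX j. f q j) \<longleftrightarrow> (\<exists>c>0. \<forall>q\<in>S. \<exists>j. c \<le> f q j)"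
proof
  assume pos: "0 < (INF q\<in>S. MAX j. f q j)"
  have bdd: "bdd_below ((\<lambda>q. MAX j. f q j) ` S)"
    by (rule bdd_belowI[of _ 0]) (auto simp: Max_ge_iff nonneg)
  have "\<exists>j. (INF q\<in>S. MAX j. f q j) \<le> f q j" if "q \<in> S" for q
    using cINF_lower[OF bdd that] by (auto simp: Max_ge_iff)
  with pos show "\<exists>c>0. \<forall>q\<in>S. \<exists>j. c \<le> f q j" by blast
next
  assume "\<exists>c>0. \<forall>q\<in>S. \<exists>j. c \<le> f q j"
  then obtain c where c: "c > 0" "\<And>q. q \<in> S \<Longrightarrow> \<exists>j. c \<le> f q j" by blast
  have "c \<le> (INF q\<in>S. MAX j. f q j)"
    using c by (intro cINF_greatest assms) (auto simp: Max_ge_iff)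
  with c show "0 < (INF q\<in>S. MAX j. f q j)" by linarith
qed

lemma Bad_iff:
  fixes k :: "real ^ 'n" and L :: "real ^ 'm ^ 'n"
  shows "L \<in> Bad k \<longleftrightarrow> (\<exists>c>0. \<forall>q\<in>int_lattice - {0}. \<exists>j.
    c \<le> infnorm q powr (real CARD('m) * k $ j) * dist_int ((L *v q) $ j))"
  unfolding Bad_def mem_Collect_eq
  by (intro INF_MAX_pos_iff int_lattice_nonzero_ex) (simp add: dist_int_nonneg)

lemma inhom_bad_iff:
  fixes k :: "real ^ 'n" and L :: "real ^ 'm ^ 'n"
  shows "inhom_bad k L \<alpha> \<longleftrightarrow> (\<exists>c>0. \<forall>q\<in>int_lattice - {0}. \<exists>j.
    c \<le> infnorm q powr (real CARD('m) * k $ j) * dist_int ((L *v q) $ j - \<alpha> $ j))"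
  unfolding inhom_bad_def
  by (intro INF_MAX_pos_iff int_lattice_nonzero_ex) (simp add: dist_int_nonneg)

section \<open>Pigeonhole principle for systems of linear forms\<close>

text \<open>The images of the box, translated by each \<open>z s\<close>, are sorted modulo 1 into
  cells with sides \<open>1 / Y j\<close>; two of them share a cell. With \<open>N = 1\<close> this
  is Dirichlet's theorem; several translates serve the transference argument.\<close>

lemma pigeonhole_forms:
  fixes M :: "real ^ 'a ^ 'b" and z :: "nat \<Rightarrow> real ^ 'b"
    and X :: "'a \<Rightarrow> nat" and Y :: "'b \<Rightarrow> nat"
  assumes Y: "\<And>j. 0 < Y j" and less: "(\<Prod>j\<in>UNIV. Y j) < N * (\<Prod>i\<in>UNIV. X i)"
  obtains s t q y where "s < N" "t < N" "q \<in> int_lattice" "y \<in> int_lattice" "s \<noteq> t \<or> q \<noteq> 0"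
    "\<And>i. \<bar>q $ i\<bar> < real (X i)"
    "\<And>j. \<bar>(M *v q) $ j + z s $ j - z t $ j - y $ j\<bar> < 1 / real (Y j)"
proof -
  define A where "A = {..<N} \<times> Pi\<^sub>E UNIV (\<lambda>i. {..<X i})"
  define B where "B = Pi\<^sub>E UNIV (\<lambda>j. {..<Y j})"
  define vec where "vec x = (\<chi> i. real (x i))" for x :: "'a \<Rightarrow> nat"
  define g where "g a = M *v vec (snd a) + z (fst a)" for a
  \<comment> \<open>The cell of the unit torus that contains \<open>g a\<close>, one index per
    coordinate.\<close>
  define f where "f a = (\<lambda>j. nat \<lfloor>real (Y j) * frac (g a $ j)\<rfloor>)" for a
  have "f ` A \<subseteq> B"
  proof -
    have "nat \<lfloor>real (Y j) * frac v\<rfloor> < Y j" for j v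
    proof -
      have "real (Y j) * frac v < real (Y j)"
        using Y[of j] by (simp add: frac_lt_1)
      then have "\<lfloor>real (Y j) * frac v\<rfloor> < int (Y j)" by linarith
      with Y[of j] show ?thesis by (simp add: nat_less_iff)
    qed
    then show ?thesis by (auto simp: f_def B_def)
  qed
  moreover have "card B < card A" "finite B"
    using less by (simp_all add: A_def B_def card_PiE card_cartesian_product)
      (rule finite_PiE; simp)
  ultimately have "\<not> inj_on f A"
    by (metis card_inj_on_le not_less)
  then obtain a b where ab: "a \<in> A" "b \<in> A" "a \<noteq> b" "f a = f b"
    by (auto simp: inj_on_def)
  define q where "q = vec (snd a) - vec (snd b)"
  \<comment> \<open>Subtracting the integer parts leaves exactly the difference of the two
    fractional parts, which lie in the same cell.\<close>
  define y :: "real ^ 'b" where "y = (\<chi> j. of_int (\<lfloor>g a $ j\<rfloor> - \<lfloor>g b $ j\<rfloor>))"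
  show thesis
  proof (rule that[of "fst a" "fst b" q y])
    show "fst a < N" "fst b < N" using ab by (auto simp: A_def)
    show "q \<in> int_lattice" "y \<in> int_lattice"
      by (auto simp: q_def y_def vec_def int_lattice_def)
    show "fst a \<noteq> fst b \<or> q \<noteq> 0"
    proof (rule ccontr)
      assume "\<not> ?thesis"
      then have "fst a = fst b" "snd a = snd b"
        by (auto simp: q_def vec_def vec_eq_iff fun_eq_iff)
      with ab show False by (simp add: prod_eq_iff)
    qed
    show "\<bar>q $ i\<bar> < real (X i)" for i
    proof -
      have "snd a i < X i" "snd b i < X i"
        using ab by (auto simp: A_def PiE_def Pi_def)
      then show ?thesis by (simp add: q_def vec_def)
    qed
    show "\<bar>(M *v q) $ j + z (fst a) $ j - z (fst b) $ j - y $ j\<bar> < 1 / real (Y j)" for j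
    proof -
      let ?u = "real (Y j) * frac (g a $ j)" and ?v = "real (Y j) * frac (g b $ j)"
      have "0 \<le> ?u" "0 \<le> ?v" by (simp_all add: frac_ge_0)
      moreover have "nat \<lfloor>?u\<rfloor> = nat \<lfloor>?v\<rfloor>"
        using ab(4) by (simp add: f_def fun_eq_iff)
      ultimately have "\<lfloor>?u\<rfloor> = \<lfloor>?v\<rfloor>"
        by (metis eq_nat_nat_iff zero_le_floor)
      then have "\<bar>?u - ?v\<bar> < 1" by linarith
      then have "real (Y j) * \<bar>frac (g a $ j) - frac (g b $ j)\<bar> < 1"
        by (simp add: abs_mult flip: right_diff_distrib)
      then have "\<bar>frac (g a $ j) - frac (g b $ j)\<bar> < 1 / real (Y j)"
        using Y[of j] by (simp add: field_simps)
      moreover have "(M *v q) $ j + z (fst a) $ j - z (fst b) $ j - y $ j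
          = frac (g a $ j) - frac (g b $ j)"
        by (simp add: q_def y_def g_def frac_def matrix_vector_mult_diff_distrib)
      ultimately show ?thesis by simp
    qed
  qed
qed

section \<open>Dual vectors: transference and Dirichlet's theorem\<close>

text \<open>The weighted box has the volume of the cube with side \<open>T\<close> in dimension
  \<open>m\<close>; this balance lets both pigeonhole counts below hold with constants independent
  of \<open>T\<close>.\<close>

lemma prod_powr_weights:
  fixes k :: "real ^ 'n"
  assumes "(\<Sum>j\<in>UNIV. k $ j) = 1" "0 < T"
  shows "(\<Prod>j\<in>UNIV. T powr (real m * k $ j)) = T ^ m"
proof -
  have "(\<Prod>j\<in>UNIV. T powr (real m * k $ j)) = T powr (\<Sum>j\<in>UNIV. real m * k $ j)"
    using assms(2) by (simp add: powr_sum)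
  then show ?thesis
    using assms by (simp add: powr_realpow flip: sum_distrib_left)
qed

lemma inner_int_lattice:
  fixes u v :: "real ^ 'd"
  assumes "u \<in> int_lattice" "v \<in> int_lattice"
  shows "u \<bullet> v \<in> \<int>"
  using assms unfolding inner_vec_def int_lattice_def by (auto intro!: Ints_sum Ints_mult)

lemma inner_transpose_matrix_vector:
  fixes L :: "real ^ 'm ^ 'n"
  shows "(transpose L *v u) \<bullet> q = u \<bullet> (L *v q)"
  by (metis dot_lmul_matrix transpose_matrix_vector)

lemma abs_inner_le_sum:
  fixes u v :: "real ^ 'd"
  shows "\<bar>u \<bullet> v\<bar> \<le> (\<Sum>i\<in>UNIV. \<bar>u $ i\<bar> * \<bar>v $ i\<bar>)"
  unfolding inner_vec_def by (rule order_trans[OF sum_abs]) (simp add: abs_mult)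

text \<open>Transference. A short vector \<open>(u, v)\<close> of the dual lattice, with \<open>s = L\<^sup>T u - v\<close>, pairs with
  \<open>(q, L q - y)\<close> to an integer. The translates \<open>z i\<close> pair with it to \<open>i / N\<close>, so they
  are far apart modulo the primal lattice, and too many of them violate the volume bound.\<close>

lemma Bad_transpose:
  fixes k :: "real ^ 'n" and L :: "real ^ 'm ^ 'n"
  assumes k: "\<And>j. 0 < k $ j" and sum_k: "(\<Sum>j\<in>UNIV. k $ j) = 1" and L: "L \<in> Bad k"
  obtains e where "0 < e" "e \<le> 1"
    "\<And>T u. \<lbrakk>1 \<le> T; u \<in> int_lattice; u \<noteq> 0;
        \<And>j. \<bar>u $ j\<bar> \<le> e * real T powr (real CARD('m) * k $ j)\<rbrakk>
      \<Longrightarrow> \<exists>i. e / real T < dist_int ((transpose L *v u) $ i)"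
proof -
  let ?m = "real CARD('m)" and ?n = "real CARD('n)"
  obtain c0 where c0: "0 < c0" "\<And>q. q \<in> int_lattice - {0} \<Longrightarrow> 
      \<exists>j. c0 \<le> infnorm q powr (?m * k $ j) * dist_int ((L *v q) $ j)"
    using L unfolding Bad_iff by blast
  \<comment> \<open>With \<open>c \<le> 1\<close> the numbers rounded up in \<open>Y\<close> below
    are at least 1, so rounding at most doubles them.\<close>
  define c where "c = min c0 1"
  have c: "0 < c" "c \<le> 1" using c0 by (auto simp: c_def)
  have bad: "\<exists>j. c \<le> infnorm q powr (?m * k $ j) * dist_int ((L *v q) $ j)"
    if "q \<in> int_lattice" "q \<noteq> 0" for q
    using c0(2)[of q] that unfolding c_def by (meson DiffI min.coboundedI1 singletonD)
  \<comment> \<open>\<open>(2 / c) ^ CARD('n)\<close> bounds the ratio of the number of cells to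
    \<open>T ^ CARD('m)\<close>, so \<open>N\<close> translates overfill the cells.\<close>
  define N where "N = nat \<lceil>(2 / c) ^ CARD('n)\<rceil> + 1"
  have N: "(2 / c) ^ CARD('n) < real N" "0 < N"
    unfolding N_def by linarith+
  \<comment> \<open>Makes the total pairing error \<open>(?n + ?m) * e\<close> equal to half the
    spacing \<open>1 / N\<close> of the values \<open>u \<bullet> z i\<close>.\<close>
  define e where "e = 1 / (2 * (?n + ?m) * real N)"
  have nm: "1 \<le> ?n" "1 \<le> ?m" by (simp_all add: Suc_leI)
  have "0 < 1 / (2 * A * real N) \<and> A * (1 / (2 * A * real N)) = 1 / (2 * real N)" if "0 < A" for A
    using N(2) that by simp
  from this[of "?n + ?m"] have "0 < e" "(?n + ?m) * e = 1 / (2 * real N)"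
    using nm unfolding e_def by linarith+
  moreover have "1 / (2 * real N) < 1 / real N"
    using N(2) by (simp add: field_simps)
  ultimately have e: "0 < e" "(?n + ?m) * e < 1 / real N" by simp_all
  have "1 \<le> ?n + ?m" using nm by linarith
  have e1: "e \<le> 1"
  proof -
    have "1 * 1 \<le> (?n + ?m) * real N"
      using N \<open>1 \<le> ?n + ?m\<close> by (intro mult_mono) auto
    then show ?thesis by (simp add: e_def field_simps)
  qed
  show thesis
  proof (rule that[OF e(1) e1])
    fix T :: nat and u :: "real ^ 'n"
    assume T: "1 \<le> T" and u: "u \<in> int_lattice" "u \<noteq> 0"
      and small: "\<And>j. \<bar>u $ j\<bar> \<le> e * real T powr (?m * k $ j)"
    show "\<exists>i. e / real T < dist_int ((transpose L *v u) $ i)"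
    proof (rule ccontr)
      assume "\<not> ?thesis"
      then have "\<forall>i. \<exists>v\<in>\<int>. \<bar>(transpose L *v u) $ i - v\<bar> \<le> e / real T"
        by (metis dist_int_attained not_less)
      then obtain v0 where v0: "\<And>i. v0 i \<in> \<int>" "\<And>i. \<bar>(transpose L *v u) $ i - v0 i\<bar> \<le> e / real T"
        by metis
      define v where "v = (\<chi> i. v0 i)"
      define s where "s = transpose L *v u - v"
      have v: "v \<in> int_lattice" using v0 by (simp add: v_def int_lattice_def)
      have s: "\<bar>s $ i\<bar> \<le> e / real T" for i using v0 by (simp add: s_def v_def)
      obtain j0 where j0: "u $ j0 \<noteq> 0" using u(2) by (auto simp: vec_eq_iff)
      define z where "z i = axis j0 (real i / (real N * u $ j0))" for i
      \<comment> \<open>Cells of side at most \<open>c / T powr (?m * k $ j)\<close>, so that a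
        nonzero \<open>q\<close> with \<open>L q\<close> this close to an integer vector contradicts
        the badness of \<open>L\<close>.\<close>
      define Y where "Y j = nat \<lceil>real T powr (?m * k $ j) / c\<rceil>" for j
      have P: "1 \<le> real T powr (?m * k $ j)" for j
        using T k[of j] by (intro ge_one_powr_ge_zero) auto
      have Pc: "1 \<le> real T powr (?m * k $ j) / c" for j
        using P[of j] c by (simp add: field_simps)
      have Y: "real T powr (?m * k $ j) / c \<le> real (Y j)"
        "real (Y j) \<le> (2 / c) * real T powr (?m * k $ j)" for j
      proof -
        show "real T powr (?m * k $ j) / c \<le> real (Y j)"
          unfolding Y_def by linarith
        have "real (Y j) \<le> real T powr (?m * k $ j) / c + 1"
          using Pc[of j] unfolding Y_def by linarith
        also have "\<dots> \<le> 2 * (real T powr (?m * k $ j) / c)" using Pc[of j] by linarith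
        finally show "real (Y j) \<le> (2 / c) * real T powr (?m * k $ j)" by simp
      qed
      have Ypos: "0 < Y j" for j
        using Y(1)[of j] Pc[of j] by linarith
      have "(\<Prod>j\<in>UNIV. real (Y j)) \<le> (\<Prod>j\<in>UNIV. (2 / c) * real T powr (?m * k $ j))"
        using Y by (intro prod_mono) auto
      also have "\<dots> = (2 / c) ^ CARD('n) * real T ^ CARD('m)"
        using T prod_powr_weights[OF sum_k, of "real T" "CARD('m)"]
        by (simp only: prod.distrib) simp
      also have "\<dots> < real N * real T ^ CARD('m)"
        using N T by (intro mult_strict_right_mono) auto
      finally have "real (\<Prod>j\<in>UNIV. Y j) < real (N * (\<Prod>i\<in>(UNIV::'m set). T))"
        by simp
      then have less: "(\<Prod>j\<in>UNIV. Y j) < N * (\<Prod>i\<in>(UNIV::'m set). T)"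
        by (simp only: of_nat_less_iff)
      from pigeonhole_forms[OF Ypos less, where M = L and z = z]
      obtain a b q y where ab: "a < N" "b < N" and q: "q \<in> int_lattice" and y: "y \<in> int_lattice"
        and ne: "a \<noteq> b \<or> q \<noteq> 0" and qT: "\<And>i. \<bar>q $ i\<bar> < real T"
        and d: "\<And>j. \<bar>(L *v q) $ j + z a $ j - z b $ j - y $ j\<bar> < 1 / real (Y j)"
        by metis
      have d': "\<bar>(L *v q) $ j + z a $ j - z b $ j - y $ j\<bar> < c / real T powr (?m * k $ j)" for j
      proof -
        have "1 / real (Y j) \<le> 1 / (real T powr (?m * k $ j) / c)"
          using Y(1)[of j] Pc[of j] by (intro divide_left_mono mult_pos_pos) auto
        with d[of j] show ?thesis by simp
      qed
      show False
      proof (cases "a = b")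
        \<comment> \<open>Same translate: it cancels, and the nonzero \<open>q\<close> with norm
          below \<open>T\<close> violates the badness of \<open>L\<close>.\<close>
        case True
        with ne have "q \<noteq> 0" by simp
        then obtain j where j: "c \<le> infnorm q powr (?m * k $ j) * dist_int ((L *v q) $ j)"
          using bad q by blast
        have "infnorm q powr (?m * k $ j) \<le> real T powr (?m * k $ j)"
          using infnorm_less_cart[of q, OF qT] k[of j]
          by (intro powr_mono2) (auto simp: infnorm_pos_le)
        then have "infnorm q powr (?m * k $ j) * dist_int ((L *v q) $ j)
          \<le> real T powr (?m * k $ j) * dist_int ((L *v q) $ j)"
          by (intro mult_right_mono dist_int_nonneg)
        moreover have "dist_int ((L *v q) $ j) < c / real T powr (?m * k $ j)"
          using d'[of j] dist_int_le[of "y $ j" "(L *v q) $ j"] y True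
          by (simp add: int_lattice_def)
        then have "real T powr (?m * k $ j) * dist_int ((L *v q) $ j) < c"
          using P[of j]
          by (subst mult.commute, subst pos_less_divide_eq[symmetric]) (linarith, simp)
        ultimately show False using j by linarith
      next
        case False
        \<comment> \<open>Different translates: pairing \<open>w\<close> with \<open>u\<close> gives
          \<open>(a - b) / N\<close> up to an integer and the small error
          \<open>s \<bullet> q\<close>.\<close>
        define w where "w = L *v q + z a - z b - y"
        have uz: "u \<bullet> z i = real i / real N" for i
          using j0 by (simp add: z_def inner_axis)
        have "u \<bullet> (L *v q) = v \<bullet> q + s \<bullet> q"
          unfolding s_def inner_transpose_matrix_vector[symmetric] by (simp add: inner_diff_left)
        then have eq: "u \<bullet> w - s \<bullet> q = (real a - real b) / real N + (v \<bullet> q - u \<bullet> y)"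
          by (simp add: w_def inner_diff_right inner_add_right uz diff_divide_distrib)
        have "\<bar>u \<bullet> w\<bar> \<le> (\<Sum>j\<in>UNIV. \<bar>u $ j\<bar> * \<bar>w $ j\<bar>)" by (rule abs_inner_le_sum)
        also have "\<dots> \<le> (\<Sum>j\<in>(UNIV::'n set). e)"
        proof (rule sum_mono)
          fix j
          have "\<bar>u $ j\<bar> * \<bar>w $ j\<bar> \<le> (e * real T powr (?m * k $ j)) * (c / real T powr (?m * k $ j))"
            using small[of j] d'[of j] e by (intro mult_mono) (auto simp: w_def)
          also have "\<dots> \<le> e" using P[of j] c e by (simp add: field_simps)
          finally show "\<bar>u $ j\<bar> * \<bar>w $ j\<bar> \<le> e" .
        qed
        also have "\<dots> = ?n * e" by simp
        finally have 1: "\<bar>u \<bullet> w\<bar> \<le> ?n * e" .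
        have "\<bar>s \<bullet> q\<bar> \<le> (\<Sum>i\<in>UNIV. \<bar>s $ i\<bar> * \<bar>q $ i\<bar>)" by (rule abs_inner_le_sum)
        also have "\<dots> \<le> (\<Sum>i\<in>(UNIV::'m set). e)"
        proof (rule sum_mono)
          fix i
          have "\<bar>s $ i\<bar> * \<bar>q $ i\<bar> \<le> (e / real T) * real T"
            using s[of i] qT[of i] e by (intro mult_mono) auto
          then show "\<bar>s $ i\<bar> * \<bar>q $ i\<bar> \<le> e" using T by simp
        qed
        also have "\<dots> = ?m * e" by simp
        finally have 2: "\<bar>s \<bullet> q\<bar> \<le> ?m * e" .
        have "\<bar>(real a - real b) / real N + (v \<bullet> q - u \<bullet> y)\<bar> < 1 / real N"
          unfolding eq[symmetric] using 1 2 e(2) by (simp add: distrib_right)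
        then have "real N * \<bar>(real a - real b) / real N + (v \<bullet> q - u \<bullet> y)\<bar> < 1"
          using N(2) by (simp add: pos_less_divide_eq mult.commute)
        moreover have "(real a - real b) + real N * (v \<bullet> q - u \<bullet> y)
            = real N * ((real a - real b) / real N + (v \<bullet> q - u \<bullet> y))"
          using N(2) by (simp add: distrib_left)
        ultimately have lt: "\<bar>(real a - real b) + real N * (v \<bullet> q - u \<bullet> y)\<bar> < 1"
          by (simp only: abs_mult abs_of_nat)
        have "v \<bullet> q - u \<bullet> y \<in> \<int>"
          using u v q y by (intro Ints_diff inner_int_lattice)
        then obtain l where l: "v \<bullet> q - u \<bullet> y = of_int l" by (auto elim: Ints_cases)
        \<comment> \<open>An integer of absolute value below 1 vanishes, so \<open>a\<close> and
          \<open>b\<close> are congruent modulo \<open>N\<close>, although both are smaller than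
          \<open>N\<close> and distinct.\<close>
        have "real_of_int \<bar>int a - int b + int N * l\<bar> < 1"
          using lt unfolding l by simp
        then have z: "int a - int b + int N * l = 0" by linarith
        then have "int N dvd int a - int b"
          by (metis add_eq_0_iff dvd_minus_iff dvd_triv_left)
        then have "int a mod int N = int b mod int N" by (simp add: mod_eq_dvd_iff)
        with ab False show False by simp
      qed
    qed
  qed
qed

text \<open>Dirichlet's box is stretched in direction \<open>j0\<close> and shrunk by \<open>e\<close> in all others. As the
  transposed system is badly approximable too, the vector found must be long in direction \<open>j0\<close>.\<close>

lemma exists_dual_vector:
  fixes k :: "real ^ 'n" and L :: "real ^ 'm ^ 'n" and j0 :: 'n
  assumes k: "\<And>j. 0 < k $ j" and sum_k: "(\<Sum>j\<in>UNIV. k $ j) = 1" and L: "L \<in> Bad k"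
  obtains e K T0 where "0 < e" "e \<le> 1" "0 < K" 
    "\<And>T. T0 \<le> T \<Longrightarrow> \<exists>u \<in> int_lattice. e * real T powr (real CARD('m) * k $ j0) < \<bar>u $ j0\<bar>
       \<and> (\<forall>j. \<bar>u $ j\<bar> \<le> K * real T powr (real CARD('m) * k $ j))
       \<and> (\<forall>i. real T * dist_int ((transpose L *v u) $ i) \<le> 1)"
proof -
  let ?m = "real CARD('m)" and ?n = "real CARD('n)"
  obtain e where e: "0 < e" "e \<le> 1" and bad: "\<And>T u. \<lbrakk>1 \<le> T; u \<in> int_lattice; u \<noteq> 0;
        \<And>j. \<bar>u $ j\<bar> \<le> e * real T powr (?m * k $ j)\<rbrakk>
      \<Longrightarrow> \<exists>i. e / real T < dist_int ((transpose L *v u) $ i)"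
    using Bad_transpose[OF assms] by metis
  \<comment> \<open>Pays for the factors lost in the count: \<open>(e / 2) ^ CARD('n)\<close> from
    the shrunken and rounded sides, and \<open>(2 / e) ^ CARD('m)\<close> from the finer
    cells.\<close>
  define K where "K = 2 * (2 / e) ^ (CARD('n) + CARD('m))"
  have K: "1 \<le> K"
  proof -
    have "1 \<le> (2 / e) ^ (CARD('n) + CARD('m))"
      using e by (intro one_le_power) (simp add: field_simps)
    then show ?thesis by (simp add: K_def)
  qed
  \<comment> \<open>Beyond this threshold rounding a side \<open>e * T powr (?m * k $ j)\<close>
    down loses at most a factor 2.\<close>
  have "\<forall>\<^sub>F T in sequentially. 1 \<le> T \<and> (\<forall>j. 1 \<le> e * real T powr (?m * k $ j))"
  proof (intro eventually_conj eventually_all_finite)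
    show "\<forall>\<^sub>F T::nat in sequentially. 1 \<le> T" by (rule eventually_ge_at_top)
    fix j
    show "\<forall>\<^sub>F T in sequentially. 1 \<le> e * real T powr (?m * k $ j)"
      using eventually_ge_at_top[of "nat \<lceil>(1 / e) powr (1 / (?m * k $ j))\<rceil>"]
    proof eventually_elim
      case (elim T)
      have "1 / e = ((1 / e) powr (1 / (?m * k $ j))) powr (?m * k $ j)"
        using e k[of j] by (simp add: powr_powr)
      also have "\<dots> \<le> real T powr (?m * k $ j)"
        using elim k[of j] by (intro powr_mono2) (auto simp: nat_le_iff ceiling_le_iff)
      finally show ?case using e by (simp add: field_simps)
    qed
  qed
  then obtain T0 where T0: "\<And>T. T0 \<le> T \<Longrightarrow> 1 \<le> T \<and> (\<forall>j. 1 \<le> e * real T powr (?m * k $ j))"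
    by (auto simp: eventually_sequentially)
  show thesis
  \<comment> \<open>The extra 1 absorbs the rounding up of the side in direction
    \<open>j0\<close>.\<close>
  proof (rule that[OF e, of "K + 1" T0])
    show "0 < K + 1" using K by simp
    fix T assume "T0 \<le> T"
    then have T: "1 \<le> T" and eT: "\<And>j. 1 \<le> e * real T powr (?m * k $ j)"
      using T0 by auto
    \<comment> \<open>Sides other than \<open>j0\<close> are rounded down, so that those components
      of \<open>u\<close> stay within the bound \<open>e\<close> of the transposed badness.\<close>
    define X where "X j = (if j = j0 then nat \<lceil>K * real T powr (?m * k $ j)\<rceil>
      else nat \<lfloor>e * real T powr (?m * k $ j)\<rfloor>)" for j
    define Y where "Y = nat \<lceil>real T / e\<rceil>"
    have Te: "1 \<le> real T / e" using T e by (simp add: field_simps)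
    have Y: "0 < Y" "real T / e \<le> real Y" "real Y \<le> (2 / e) * real T"
    proof -
      show "0 < Y" "real T / e \<le> real Y"
        using Te unfolding Y_def by linarith+
      have "real Y \<le> 2 * (real T / e)" using Te unfolding Y_def by linarith
      then show "real Y \<le> (2 / e) * real T" by simp
    qed
    have X_le: "real (X j) \<le> e * real T powr (?m * k $ j)" if "j \<noteq> j0" for j
      using that eT[of j] by (simp add: X_def)
    \<comment> \<open>The factor at \<open>j0\<close> combines with \<open>e / 2\<close> to
      \<open>K\<close>; taking out \<open>e / 2\<close> in every direction leaves a product that
      differs from a constant one at \<open>j0\<close> only.\<close>
    have X_ge: "(if j = j0 then K * (2 / e) else 1) * ((e / 2) * real T powr (?m * k $ j)) \<le> real (X j)" for j
    proof (cases "j = j0")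
      case True
      then show ?thesis using e unfolding X_def by simp linarith
    next
      case False
      have "v / 2 \<le> real (nat \<lfloor>v\<rfloor>)" if "1 \<le> v" for v :: real
      proof -
        have "1 \<le> \<lfloor>v\<rfloor>" using that by simp
        then show ?thesis by linarith
      qed
      from this[OF eT[of j]]
      have "e * real T powr (?m * k $ j) / 2 \<le> real (nat \<lfloor>e * real T powr (?m * k $ j)\<rfloor>)" .
      with False show ?thesis by (simp add: X_def)
    qed
    have "(\<Prod>i\<in>(UNIV::'m set). real Y) \<le> ((2 / e) * real T) ^ CARD('m)"
      using Y(3) by (simp add: power_mono)
    also have "\<dots> = (2 / e) ^ CARD('m) * real T ^ CARD('m)"
      by (rule power_mult_distrib)
    also have "\<dots> < (K * (2 / e) * (e / 2) ^ CARD('n)) * real T ^ CARD('m)"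
    proof (rule mult_strict_right_mono)
      have "(2 / e) ^ CARD('n) * (e / 2) ^ CARD('n) = 1"
        using e by (simp flip: power_mult_distrib)
      then have "K * (2 / e) * (e / 2) ^ CARD('n) = 2 * (2 / e) * (2 / e) ^ CARD('m)"
        by (simp add: K_def power_add)
      moreover have "1 < 2 * (2 / e)" using e by (simp add: field_simps)
      then have "1 * (2 / e) ^ CARD('m) < 2 * (2 / e) * (2 / e) ^ CARD('m)"
        using e by (intro mult_strict_right_mono) auto
      ultimately show "(2 / e) ^ CARD('m) < K * (2 / e) * (e / 2) ^ CARD('n)"
        by (simp only: mult_1)
    qed (use T in auto)
    also have "\<dots> = (\<Prod>j\<in>UNIV. (if j = j0 then K * (2 / e) else 1) * ((e / 2) * real T powr (?m * k $ j)))"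
      using T prod_powr_weights[OF sum_k, of "real T" "CARD('m)"]
      by (simp only: prod.distrib) (simp add: prod.delta)
    also have "\<dots> \<le> (\<Prod>j\<in>UNIV. real (X j))"
      using X_ge e K by (intro prod_mono) auto
    finally have "real (\<Prod>i\<in>(UNIV::'m set). Y) < real (1 * (\<Prod>j\<in>UNIV. X j))" by simp
    then have less: "(\<Prod>i\<in>(UNIV::'m set). Y) < 1 * (\<Prod>j\<in>UNIV. X j)"
      by (simp only: of_nat_less_iff)
    \<comment> \<open>There is one translate, zero, so the two indices agree and \<open>u\<close>
      must be nonzero.\<close>
    obtain a b u y where ab: "a < (1::nat)" "b < (1::nat)" and u: "u \<in> int_lattice"
      and y: "y \<in> int_lattice" and ne: "a \<noteq> b \<or> u \<noteq> 0" and uX: "\<And>j. \<bar>u $ j\<bar> < real (X j)"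
      and d: "\<And>i. \<bar>(transpose L *v u) $ i + 0 $ i - 0 $ i - y $ i\<bar> < 1 / real Y"
      by (rule pigeonhole_forms[OF Y(1) less, where M = "transpose L" and z = "\<lambda>_. 0"]) (rule that)
    have "u \<noteq> 0" using ab ne by simp
    have dist: "dist_int ((transpose L *v u) $ i) \<le> e / real T" for i
    proof -
      have "dist_int ((transpose L *v u) $ i) \<le> 1 / real Y"
        using d[of i] dist_int_le[of "y $ i" "(transpose L *v u) $ i"] y
        by (simp add: int_lattice_def)
      also have "\<dots> \<le> 1 / (real T / e)"
        using Y Te by (intro divide_left_mono mult_pos_pos) auto
      finally show ?thesis by simp
    qed
    show "\<exists>u \<in> int_lattice. e * real T powr (?m * k $ j0) < \<bar>u $ j0\<bar>
       \<and> (\<forall>j. \<bar>u $ j\<bar> \<le> (K + 1) * real T powr (?m * k $ j))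
       \<and> (\<forall>i. real T * dist_int ((transpose L *v u) $ i) \<le> 1)"
    proof (intro bexI[OF _ u] conjI allI)
      show "e * real T powr (?m * k $ j0) < \<bar>u $ j0\<bar>"
      proof (rule ccontr)
        assume "\<not> ?thesis"
        then have "\<bar>u $ j\<bar> \<le> e * real T powr (?m * k $ j)" for j
          using uX[of j] X_le[of j] by (cases "j = j0") auto
        from bad[OF T u \<open>u \<noteq> 0\<close> this] dist show False by (meson not_less)
      qed
      show "real T * dist_int ((transpose L *v u) $ i) \<le> 1" for i
        using dist[of i] T e by (simp add: field_simps)
      show "\<bar>u $ j\<bar> \<le> (K + 1) * real T powr (?m * k $ j)" for j
      proof (cases "j = j0")
        case True
        have "1 \<le> real T powr (?m * k $ j)"
          using T k[of j] by (intro ge_one_powr_ge_zero) auto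
        then have "1 \<le> K * real T powr (?m * k $ j)"
          using K by (metis mult_mono' mult_1 zero_le_one)
        then have "real (X j) \<le> K * real T powr (?m * k $ j) + 1"
          using True unfolding X_def by simp
        then show ?thesis
          using uX[of j] \<open>1 \<le> real T powr (?m * k $ j)\<close> by (simp add: distrib_right)
      next
        case False
        have "e * real T powr (?m * k $ j) \<le> (K + 1) * real T powr (?m * k $ j)"
          using e K by (intro mult_right_mono) auto
        with uX[of j] X_le[OF False] show ?thesis by linarith
      qed
    qed
  qed
qed

section \<open>From dual vectors to the inhomogeneous condition\<close>

text \<open>Up to an integer, \<open>u \<bullet> \<alpha>\<close> is
  \<open>s \<bullet> q - u \<bullet> w\<close>, with \<open>s\<close> and \<open>w\<close> the
  errors of \<open>L\<^sup>T u\<close> and \<open>L q - \<alpha>\<close>. The lower bound on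
  \<open>T\<close> keeps the first term within \<open>g / 2\<close>, so \<open>u \<bullet> w\<close>
  has size at least \<open>g / 2\<close> and some component of \<open>w\<close> is large. The upper
  bound on \<open>T\<close> expresses the size of \<open>u\<close> through \<open>q\<close>.\<close>

lemma inhom_badI:
  fixes k :: "real ^ 'n" and L :: "real ^ 'm ^ 'n"
  assumes k: "\<And>j. 0 < k $ j" and sum_k: "(\<Sum>j\<in>UNIV. k $ j) = 1"
    and pos: "0 < g" "0 < K"
    and dual: "\<And>Q. 1 \<le> Q \<Longrightarrow> \<exists>T u. 2 * real CARD('m) / g * Q \<le> T \<and> T \<le> C * Q \<and> u \<in> int_lattice
       \<and> (\<forall>j. \<bar>u $ j\<bar> \<le> K * T powr (real CARD('m) * k $ j))
       \<and> (\<forall>i. T * dist_int ((transpose L *v u) $ i) \<le> 1)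
       \<and> g \<le> dist_int (u \<bullet> \<alpha>)"
  shows "inhom_bad k L \<alpha>"
proof -
  let ?m = "real CARD('m)" and ?n = "real CARD('n)"
  \<comment> \<open>A base at least 1 lets \<open>D powr (?m * k $ j)\<close> be replaced by
    \<open>D powr ?m\<close> for every \<open>j\<close>, since no weight exceeds 1.\<close>
  define D where "D = max C 1"
  \<comment> \<open>Some \<open>\<bar>u $ j\<bar> * \<bar>w $ j\<bar>\<close> is at least
    \<open>g / (2 * ?n)\<close>, while \<open>\<bar>u $ j\<bar>\<close> is at most
    \<open>K * D powr ?m\<close> times the power of the norm of \<open>q\<close>.\<close>
  define c where "c = g / (2 * ?n * K * D powr ?m)"
  have D: "1 \<le> D" "C \<le> D" by (auto simp: D_def)
  have c: "0 < c" using pos D by (simp add: c_def)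
  have "\<exists>j. c \<le> infnorm q powr (?m * k $ j) * dist_int ((L *v q) $ j - \<alpha> $ j)"
    if q: "q \<in> int_lattice - {0}" for q
  proof -
    have Q: "1 \<le> infnorm q" using q one_le_infnorm by blast
    from dual[OF Q] obtain T u where T: "2 * ?m / g * infnorm q \<le> T" "T \<le> C * infnorm q"
      and u: "u \<in> int_lattice" "\<And>j. \<bar>u $ j\<bar> \<le> K * T powr (?m * k $ j)"
        "\<And>i. T * dist_int ((transpose L *v u) $ i) \<le> 1" "g \<le> dist_int (u \<bullet> \<alpha>)"
      by blast
    have Tpos: "0 < T"
      using pos Q by (intro less_le_trans[OF _ T(1)]) simp
    have "\<forall>i. \<exists>v\<in>\<int>. dist_int ((transpose L *v u) $ i) = \<bar>(transpose L *v u) $ i - v\<bar>"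
      by (metis dist_int_attained)
    then obtain v0 where v0: "\<And>i. v0 i \<in> \<int>"
        "\<And>i. dist_int ((transpose L *v u) $ i) = \<bar>(transpose L *v u) $ i - v0 i\<bar>"
      by metis
    have "\<forall>j. \<exists>p\<in>\<int>. dist_int ((L *v q) $ j - \<alpha> $ j) = \<bar>(L *v q) $ j - \<alpha> $ j - p\<bar>"
      by (metis dist_int_attained)
    then obtain p0 where p0: "\<And>j. p0 j \<in> \<int>"
        "\<And>j. dist_int ((L *v q) $ j - \<alpha> $ j) = \<bar>(L *v q) $ j - \<alpha> $ j - p0 j\<bar>"
      by metis
    define v where "v = (\<chi> i. v0 i)"
    define p where "p = (\<chi> j. p0 j)"
    define s where "s = transpose L *v u - v"
    define w where "w = L *v q - \<alpha> - p"
    have int: "v \<in> int_lattice" "p \<in> int_lattice"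
      using v0 p0 by (simp_all add: v_def p_def int_lattice_def)
    have s: "\<bar>s $ i\<bar> \<le> 1 / T" for i
      using u(3)[of i] v0(2)[of i] Tpos by (simp add: s_def v_def field_simps)
    have w: "dist_int ((L *v q) $ j - \<alpha> $ j) = \<bar>w $ j\<bar>" for j
      using p0(2) by (simp add: w_def p_def)
    have "v \<bullet> q - u \<bullet> p \<in> \<int>"
      using q by (intro Ints_diff inner_int_lattice int u(1)) simp
    then have "g \<le> \<bar>u \<bullet> \<alpha> - (v \<bullet> q - u \<bullet> p)\<bar>"
      using dist_int_le u(4) order_trans by blast
    also have "u \<bullet> \<alpha> - (v \<bullet> q - u \<bullet> p) = s \<bullet> q - u \<bullet> w"
      by (simp add: s_def w_def inner_diff_left inner_diff_right inner_transpose_matrix_vector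
          del: transpose_matrix_vector)
    also have "\<bar>s \<bullet> q - u \<bullet> w\<bar> \<le> \<bar>s \<bullet> q\<bar> + \<bar>u \<bullet> w\<bar>" by simp
    also have "\<bar>s \<bullet> q\<bar> \<le> (\<Sum>i\<in>UNIV. \<bar>s $ i\<bar> * \<bar>q $ i\<bar>)" by (rule abs_inner_le_sum)
    also have "\<dots> \<le> (\<Sum>i\<in>(UNIV::'m set). (1 / T) * infnorm q)"
      using s Tpos by (intro sum_mono mult_mono component_le_infnorm_cart) auto
    also have "\<dots> = ?m * infnorm q / T" by simp
    also have "\<dots> \<le> g / 2" using T(1) Tpos pos by (simp add: field_simps)
    finally have "g / 2 \<le> \<bar>u \<bullet> w\<bar>" by simp
    also have "\<dots> \<le> (\<Sum>j\<in>UNIV. \<bar>u $ j\<bar> * \<bar>w $ j\<bar>)" by (rule abs_inner_le_sum)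
    finally have g: "g / 2 \<le> (\<Sum>j\<in>UNIV. \<bar>u $ j\<bar> * \<bar>w $ j\<bar>)" .
    have "\<exists>j. g / (2 * ?n) \<le> \<bar>u $ j\<bar> * \<bar>w $ j\<bar>"
    proof (rule ccontr)
      assume "\<not> ?thesis"
      then have "(\<Sum>j\<in>UNIV. \<bar>u $ j\<bar> * \<bar>w $ j\<bar>) < (\<Sum>j\<in>(UNIV::'n set). g / (2 * ?n))"
        by (intro sum_strict_mono) (auto simp: not_le)
      with g show False by simp
    qed
    then obtain j where j: "g / (2 * ?n) \<le> \<bar>u $ j\<bar> * \<bar>w $ j\<bar>" by blast
    have kj: "k $ j \<le> 1"
      using member_le_sum[of j UNIV "($) k"] k sum_k by (simp add: less_imp_le)
    have "T powr (?m * k $ j) \<le> (D * infnorm q) powr (?m * k $ j)"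
    proof (rule powr_mono2)
      have "C * infnorm q \<le> D * infnorm q" using D Q by (intro mult_right_mono) auto
      with T show "T \<le> D * infnorm q" by linarith
    qed (use k[of j] Tpos in auto)
    also have "\<dots> = D powr (?m * k $ j) * infnorm q powr (?m * k $ j)"
      using D Q by (simp add: powr_mult)
    also have "\<dots> \<le> D powr ?m * infnorm q powr (?m * k $ j)"
      using D kj by (intro mult_right_mono powr_mono) auto
    finally have "K * T powr (?m * k $ j) \<le> K * (D powr ?m * infnorm q powr (?m * k $ j))"
      using pos by simp
    with u(2)[of j] have "\<bar>u $ j\<bar> \<le> K * (D powr ?m * infnorm q powr (?m * k $ j))" by linarith
    then have "\<bar>u $ j\<bar> * \<bar>w $ j\<bar> \<le> K * (D powr ?m * infnorm q powr (?m * k $ j)) * \<bar>w $ j\<bar>"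
      by (intro mult_right_mono) auto
    with j have "g / (2 * ?n) \<le> (K * D powr ?m) * (infnorm q powr (?m * k $ j) * \<bar>w $ j\<bar>)"
      by (simp add: mult_ac)
    then have "c \<le> infnorm q powr (?m * k $ j) * \<bar>w $ j\<bar>"
      using pos D by (simp add: c_def field_simps)
    then show ?thesis unfolding w[symmetric] by blast
  qed
  with c show ?thesis unfolding inhom_bad_iff by blast
qed

section \<open>Schmidt's game: escaping from hyperplanes\<close>

text \<open>The unit normal pointing away from the nearest hyperplane on which
  \<open>w \<bullet> x\<close> is an integer. For \<open>w = 0\<close> it is 0, since
  \<open>sgn 0 = 0\<close>, and Alice keeps the centre.\<close>

definition away :: "'a::real_inner \<Rightarrow> 'a \<Rightarrow> 'a"
  where "away w x = (if w \<bullet> x < of_int (round (w \<bullet> x)) then - sgn w else sgn w)"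

lemma norm_away: "norm (away w x) \<le> 1"
  by (simp add: away_def norm_sgn)

lemma inner_sgn_self: "w \<bullet> sgn w = norm (w :: 'a::real_inner)"
  by (cases "w = 0") (simp_all add: sgn_div_norm dot_square_norm power2_eq_square)

lemma dist_int_triangle: "dist_int x \<le> dist_int y + \<bar>x - y\<bar>"
  unfolding dist_int_def using infdist_triangle[of x \<int> y] by (simp add: dist_real_def)

text \<open>The ball \<open>(c', b / 2 * r)\<close> is Bob's answer. With ratio 1/2 the first move only makes Alice's
  ball tangent to the hyperplane in the worst case; the second one gains a positive distance.\<close>

lemma two_moves_away:
  fixes w :: "'a::real_inner"
  assumes r: "0 < r" and b: "0 < b" "b < 1" and wr: "norm w * r < 1/8"
    and c': "norm (c' - (c + (r / 2) *\<^sub>R away w c)) \<le> r / 2 - b / 2 * r"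
    and x: "norm (x - (c' + (b / 2 * r / 2) *\<^sub>R away w c')) \<le> b / 2 * r / 2"
  shows "norm w * (b / 2 * r) \<le> dist_int (w \<bullet> x)"
proof (cases "w = 0")
  case True
  then show ?thesis by (simp add: dist_int_nonneg)
next
  case False
  define N where "N = norm w"
  have N: "0 < N" "N * r < 1/8" using False wr by (simp_all add: N_def)
  define \<delta> where "\<delta> = N * (b / 2 * r)"
  have \<delta>: "0 < \<delta>" "\<delta> < N * r"
    using N r b by (simp_all add: \<delta>_def)
  define n where "n = round (w \<bullet> c)"
  \<comment> \<open>The side of the hyperplane \<open>w \<bullet> x = n\<close> on which
    \<open>c\<close> lies; multiplying by \<open>s\<close> makes motion away from it
    positive.\<close>
  define s :: real where "s = (if w \<bullet> c < of_int n then - 1 else 1)"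
  have away_c: "away w c = s *\<^sub>R sgn w" by (simp add: away_def s_def n_def)
  have s: "s * s = 1" "\<bar>s\<bar> = 1" by (simp_all add: s_def)
  define t where "t = s * (w \<bullet> c - of_int n)"
  have t: "0 \<le> t" "t \<le> 1/2" "dist_int (w \<bullet> c) = t"
  proof -
    have near: "\<bar>w \<bullet> c - of_int n\<bar> \<le> 1/2"
      using of_int_round_abs_le[of "w \<bullet> c"] by (simp add: n_def abs_minus_commute)
    have abs: "t = \<bar>w \<bullet> c - of_int n\<bar>" by (simp add: t_def s_def)
    with near show "0 \<le> t" "t \<le> 1/2" by simp_all
    obtain l where l: "l \<in> \<int>" "dist_int (w \<bullet> c) = \<bar>w \<bullet> c - l\<bar>" by (rule dist_int_attained)
    then obtain l' where l': "l = of_int l'" by (auto elim: Ints_cases)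
    have "\<bar>w \<bullet> c - of_int n\<bar> \<le> \<bar>w \<bullet> c - of_int l'\<bar>"
      unfolding n_def using round_diff_minimal[of "w \<bullet> c" l'] by simp
    with l l' dist_int_le[of "of_int n" "w \<bullet> c"] abs show "dist_int (w \<bullet> c) = t" by simp
  qed
  have close: "\<bar>s * (w \<bullet> y)\<bar> \<le> N * R" if "norm y \<le> R" for y R
  proof -
    have "\<bar>s * (w \<bullet> y)\<bar> = \<bar>w \<bullet> y\<bar>" by (simp add: abs_mult s)
    also have "\<dots> \<le> norm w * norm y" by (rule Cauchy_Schwarz_ineq2)
    also have "\<dots> \<le> N * R" using that unfolding N_def by (intro mult_left_mono) auto
    finally show ?thesis .
  qed
  have sN: "s * (w \<bullet> (R *\<^sub>R s *\<^sub>R sgn w)) = R * N" for R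
  proof -
    have "s * (w \<bullet> (R *\<^sub>R s *\<^sub>R sgn w)) = (s * s) * (R * (w \<bullet> sgn w))" by simp
    then show ?thesis by (simp only: s inner_sgn_self N_def mult_1)
  qed
  define y where "y = c' - (c + (r / 2) *\<^sub>R away w c)"
  have dy: "\<bar>s * (w \<bullet> y)\<bar> \<le> N * r / 2 - \<delta>"
    using close[OF c'] by (simp add: y_def \<delta>_def algebra_simps)
  have "s * (w \<bullet> c' - of_int n) = t + s * (w \<bullet> ((r / 2) *\<^sub>R s *\<^sub>R sgn w)) + s * (w \<bullet> y)"
    unfolding y_def t_def away_c by (simp add: inner_diff_right inner_add_right algebra_simps)
  then have c'_eq: "s * (w \<bullet> c' - of_int n) = t + r / 2 * N + s * (w \<bullet> y)"
    by (simp only: sN)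
  show ?thesis
  proof (cases "t \<le> 1/4")
    \<comment> \<open>Near the hyperplane: \<open>n\<close> is still the nearest integer at
      \<open>c'\<close>, so both moves go the same way. Bob can undo the first except for
      \<open>\<delta>\<close>; the second adds \<open>\<delta> / 2\<close>, which cancels the radius
      of the final ball.\<close>
    case True
    have t': "0 < s * (w \<bullet> c' - of_int n)" "s * (w \<bullet> c' - of_int n) < 1/2"
      "\<delta> \<le> s * (w \<bullet> c' - of_int n)" "s * (w \<bullet> c' - of_int n) \<le> t + N * r - \<delta>"
      using True t dy N \<delta> unfolding c'_eq by (auto simp: abs_le_iff mult.commute[of r N])
    have "\<bar>w \<bullet> c' - of_int n\<bar> = \<bar>s * (w \<bullet> c' - of_int n)\<bar>" by (simp add: abs_mult s)
    with t' have "round (w \<bullet> c') = n" by (intro round_unique') simp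
    then have away_c': "away w c' = s *\<^sub>R sgn w"
      using t'(1) by (auto simp: away_def s_def)
    define y' where "y' = x - (c' + (b / 2 * r / 2) *\<^sub>R away w c')"
    have dy': "\<bar>s * (w \<bullet> y')\<bar> \<le> \<delta> / 2"
      using close[OF x] by (simp add: y'_def \<delta>_def)
    have "s * (w \<bullet> x - of_int n)
        = s * (w \<bullet> c' - of_int n) + s * (w \<bullet> ((b / 2 * r / 2) *\<^sub>R s *\<^sub>R sgn w)) + s * (w \<bullet> y')"
      unfolding y'_def away_c' by (simp add: inner_diff_right inner_add_right algebra_simps)
    then have x_eq: "s * (w \<bullet> x - of_int n) = s * (w \<bullet> c' - of_int n) + \<delta> / 2 + s * (w \<bullet> y')"
      by (simp only: sN) (simp add: \<delta>_def)
    have x': "\<delta> \<le> s * (w \<bullet> x - of_int n)" "s * (w \<bullet> x - of_int n) < 1/2"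
      using t' True dy' N \<delta> unfolding x_eq by (auto simp: abs_le_iff)
    have "\<bar>w \<bullet> x - of_int n\<bar> = \<bar>s * (w \<bullet> x - of_int n)\<bar>" by (simp add: abs_mult s)
    with x' \<delta> have "\<bar>w \<bullet> x - of_int n\<bar> < 1/2" "\<delta> \<le> \<bar>w \<bullet> x - of_int n\<bar>" by simp_all
    then have "\<delta> \<le> dist_int (w \<bullet> x)" by (subst dist_int_eq[of "of_int n"]) auto
    then show ?thesis by (simp add: \<delta>_def N_def)
  next
    case far: False
    \<comment> \<open>Far from the hyperplane: all play stays within distance \<open>r\<close> of
      \<open>c\<close>, which changes \<open>w \<bullet> x\<close> by less than 1/8 and leaves more
      than 1/8.\<close>
    have "norm (x - c) = norm ((x - (c' + (b / 2 * r / 2) *\<^sub>R away w c'))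
        + (b / 2 * r / 2) *\<^sub>R away w c' + (y + (r / 2) *\<^sub>R away w c))"
      by (simp add: y_def)
    also have "\<dots> \<le> b / 2 * r / 2 + b / 2 * r / 2 + ((r / 2 - b / 2 * r) + r / 2)"
      using r b c' norm_away[of w c] norm_away[of w c'] unfolding y_def
      by (intro norm_triangle_le add_mono x c') (auto intro!: mult_left_le)
    also have "\<dots> = r" by simp
    finally have "\<bar>s * (w \<bullet> (x - c))\<bar> \<le> N * r" by (rule close)
    then have "\<bar>w \<bullet> c - w \<bullet> x\<bar> \<le> N * r"
      by (simp add: abs_mult s inner_diff_right abs_minus_commute)
    then have "t - N * r \<le> dist_int (w \<bullet> x)"
      using dist_int_triangle[of "w \<bullet> c" "w \<bullet> x"] t by simp
    then have "\<delta> \<le> dist_int (w \<bullet> x)" using far N \<delta> by linarith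
    then show ?thesis by (simp add: \<delta>_def N_def)
  qed
qed

text \<open>\<open>W r p\<close> guides turns \<open>2 * p\<close> and \<open>Suc (2 * p)\<close>,
  counted from 0, of a play whose first ball has radius \<open>r\<close>; Bob's radius at turn
  \<open>i\<close> is then \<open>r * (b / 2) ^ i\<close>, so each pair of turns is an instance of
  the two-move escape.\<close>

lemma winning_strategy_away:
  fixes S :: "'a::euclidean_space set" and W :: "real \<Rightarrow> nat \<Rightarrow> 'a"
  assumes b: "0 < b" "b < 1"
    and W: "\<And>r p. 0 < r \<Longrightarrow> norm (W r p) * (r * (b / 2) ^ (2 * p)) < 1/8"
    and S: "\<And>r x. \<lbrakk>0 < r; \<And>p. norm (W r p) * (r * (b / 2) ^ Suc (2 * p)) \<le> dist_int (W r p \<bullet> x)\<rbrakk>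
      \<Longrightarrow> x \<in> S"
  shows "\<exists>\<sigma>. winning_strategy (1/2) b S \<sigma>"
proof -
  \<comment> \<open>The shift is at most half of Bob's radius, exactly the room that the ratio 1/2
    leaves.\<close>
  define ans where "ans w P = (fst P + (snd P / 2) *\<^sub>R away w (fst P), snd P / 2)"
    for w and P :: "'a move"
  \<comment> \<open>At turn \<open>i\<close> the history has length \<open>i + 1\<close>, hence the
    subtraction of 1 before halving.\<close>
  define \<sigma> where "\<sigma> Bs = ans (W (snd (hd Bs)) ((length Bs - 1) div 2)) (last Bs)" for Bs
  have \<sigma>: "\<sigma> (map B [0..<Suc r]) = ans (W (snd (B 0)) (r div 2)) (B r)" for B r
    by (simp add: \<sigma>_def hd_map del: upt_Suc) (simp add: hd_map hd_append)
  have legal: "legal_reply (1/2) P (ans w P)" if "0 < snd P" for P w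
  proof -
    have "snd P * norm (away w (fst P)) \<le> snd P"
      using that by (intro mult_left_le norm_away) auto
    moreover have "dist (fst (ans w P)) (fst P) = snd P * norm (away w (fst P)) / 2"
      using that by (simp add: ans_def dist_norm)
    moreover have "snd (ans w P) = snd P / 2" by (simp add: ans_def)
    ultimately have "dist (fst (ans w P)) (fst P) + snd (ans w P) \<le> snd P" by linarith
    then show ?thesis
      by (auto simp: legal_reply_def ans_def move_ball_def cball_subset_cball_iff)
  qed
  have radius: "snd (B r) = snd (B 0) * (b / 2) ^ r \<and> 0 < snd (B r)"
    if "\<And>s. s \<le> r \<Longrightarrow> bob_legal b \<sigma> B s" for B r
    using that
  proof (induction r)
    case 0
    then show ?case by (simp add: bob_legal_def)
  next
    case (Suc r)
    then have "snd (B r) = snd (B 0) * (b / 2) ^ r" "0 < snd (B r)" by simp_all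
    moreover have "snd (B (Suc r)) = b * (snd (B r) / 2)"
      using Suc.prems[of "Suc r"] by (simp add: bob_legal_def legal_reply_def \<sigma> del: upt_Suc)
        (simp add: ans_def)
    ultimately have IH: "snd (B (Suc r)) = b / 2 * snd (B r)" "0 < snd (B r)"
      "snd (B r) = snd (B 0) * (b / 2) ^ r" by simp_all
    have "0 < snd (B (Suc r))" unfolding IH(1) using IH(2) b by simp
    moreover have "snd (B (Suc r)) = snd (B 0) * (b / 2) ^ Suc r"
      unfolding IH(1) IH(3) by simp
    ultimately show ?case by blast
  qed
  have "winning_strategy (1/2) b S \<sigma>"
    unfolding winning_strategy_def
  proof (intro conjI allI impI)
    fix B r assume "\<forall>s\<le>r. bob_legal b \<sigma> B s"
    then show "legal_reply (1/2) (B r) (\<sigma> (map B [0..<Suc r]))"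
      unfolding \<sigma> using radius[of r B] by (blast intro: legal)
  next
    fix B assume "\<forall>r. bob_legal b \<sigma> B r"
    then have bob: "bob_legal b \<sigma> B r" for r by blast
    define \<rho> where "\<rho> = snd (B 0)"
    have rad: "snd (B r) = \<rho> * (b / 2) ^ r" "0 < snd (B r)" for r
      using radius[of r B, OF bob] unfolding \<rho>_def by blast+
    have \<rho>: "0 < \<rho>" using rad(2)[of 0] by (simp add: \<rho>_def)
    define A where "A r = ans (W \<rho> (r div 2)) (B r)" for r
    have BA: "move_ball (B (Suc r)) \<subseteq> move_ball (A r)" for r
      using bob[of "Suc r"] by (simp add: bob_legal_def legal_reply_def \<sigma> A_def \<rho>_def del: upt_Suc)
    have AB: "move_ball (A r) \<subseteq> move_ball (B r)" for r
      using legal[OF rad(2)] by (simp add: A_def legal_reply_def)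
    have "\<exists>x. (\<Inter>r. move_ball (B r)) = {x}"
    proof (rule decreasing_closed_nest_sing)
      show "closed (move_ball (B n))" "move_ball (B n) \<noteq> {}" for n
        using rad(2)[of n] by (auto simp: move_ball_def)
      show "move_ball (B n) \<subseteq> move_ball (B m)" if "m \<le> n" for m n
        using subset_trans[OF BA AB] that by (rule lift_Suc_antimono_le)
      fix \<epsilon> :: real assume "0 < \<epsilon>"
      then obtain n where n: "(b / 2) ^ n < \<epsilon> / (2 * \<rho>)"
        using real_arch_pow_inv[of "\<epsilon> / (2 * \<rho>)" "b / 2"] \<rho> b by auto
      have "dist x y < \<epsilon>" if "x \<in> move_ball (B n)" "y \<in> move_ball (B n)" for x y
      proof -
        have "dist x y \<le> 2 * snd (B n)"
          using that dist_triangle3[of x y "fst (B n)"] by (auto simp: move_ball_def)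
        also have "\<dots> < \<epsilon>" using n \<rho> by (simp add: rad(1) field_simps)
        finally show ?thesis .
      qed
      then show "\<exists>n. \<forall>x\<in>move_ball (B n). \<forall>y\<in>move_ball (B n). dist x y < \<epsilon>" by blast
    qed
    then obtain x where x: "(\<Inter>r. move_ball (B r)) = {x}" by blast
    have "x \<in> S"
    proof (rule S[OF \<rho>])
      fix p
      let ?w = "W \<rho> p" and ?r = "\<rho> * (b / 2) ^ (2 * p)"
      have B0: "snd (B (2 * p)) = ?r" "snd (B (Suc (2 * p))) = b / 2 * ?r"
        by (simp_all add: rad(1))
      have A0: "A (2 * p) = ans ?w (B (2 * p))" "A (Suc (2 * p)) = ans ?w (B (Suc (2 * p)))"
        by (simp_all add: A_def)
      have "norm ?w * (b / 2 * ?r) \<le> dist_int (?w \<bullet> x)"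
      proof (rule two_moves_away[OF _ b W[OF \<rho>]])
        show "0 < ?r" using \<rho> b by simp
        show "norm (fst (B (Suc (2 * p))) - (fst (B (2 * p)) + (?r / 2) *\<^sub>R away ?w (fst (B (2 * p)))))
            \<le> ?r / 2 - b / 2 * ?r"
          using BA[of "2 * p"] rad(2)[of "Suc (2 * p)"]
          by (auto simp: move_ball_def A0 ans_def B0 cball_subset_cball_iff dist_norm)
        have "x \<in> move_ball (A (Suc (2 * p)))"
          using x BA[of "Suc (2 * p)"] by blast
        then show "norm (x - (fst (B (Suc (2 * p))) + (b / 2 * ?r / 2) *\<^sub>R away ?w (fst (B (Suc (2 * p))))))
            \<le> b / 2 * ?r / 2"
          by (simp add: move_ball_def A0 ans_def B0 dist_norm norm_minus_commute)
      qed
      then show "norm ?w * (\<rho> * (b / 2) ^ Suc (2 * p)) \<le> dist_int (?w \<bullet> x)"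
        by (simp add: mult_ac)
    qed
    with x show "\<exists>x\<in>S. (\<Inter>r. move_ball (B r)) = {x}" by blast
  qed
  then show ?thesis by blast
qed

section \<open>Matching the scales of the dual vectors with the radii of the game\<close>

text \<open>The first term to reach \<open>Z\<close> overshoots by at most the factor
  \<open>\<Omega>\<close>, unless it is the initial term \<open>t\<close>.\<close>

lemma geometric_sequence_hits:
  fixes t \<Omega> Z :: real
  assumes "0 < t" "1 < \<Omega>" "0 \<le> Z"
  obtains p where "Z \<le> t * \<Omega> ^ p" "t * \<Omega> ^ p \<le> t + \<Omega> * Z"
proof -
  obtain p0 where "Z / t < \<Omega> ^ p0" using real_arch_pow[OF \<open>1 < \<Omega>\<close>] by blast
  then have ex: "Z \<le> t * \<Omega> ^ p0" using assms by (simp add: field_simps)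
  define p where "p = (LEAST p. Z \<le> t * \<Omega> ^ p)"
  have p: "Z \<le> t * \<Omega> ^ p" unfolding p_def using ex by (rule LeastI)
  moreover have "t * \<Omega> ^ p \<le> t + \<Omega> * Z"
  proof (cases p)
    case 0
    then show ?thesis using assms by simp
  next
    case (Suc p')
    then have "t * \<Omega> ^ p' < Z" using not_less_Least[of p' "\<lambda>p. Z \<le> t * \<Omega> ^ p"]
      by (simp add: p_def[symmetric])
    then have "\<Omega> * (t * \<Omega> ^ p') \<le> \<Omega> * Z" using assms by (intro mult_left_mono) auto
    moreover have "t * \<Omega> ^ p = \<Omega> * (t * \<Omega> ^ p')" using Suc by simp
    ultimately show ?thesis using \<open>0 < t\<close> by linarith
  qed
  ultimately show thesis by (rule that)
qed

theorem theorem1p1: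
  fixes k :: "real ^ 'n" and L :: "real ^ 'm ^ 'n"
  assumes "\<And>j. k $ j > 0"
    and "(\<Sum>j\<in>UNIV. k $ j) = 1"
    and "L \<in> Bad k"
  shows "winning_mod_int (1/2) (Bad_inhom k L)"
  unfolding winning_mod_int_Bad_inhom_iff winning_def
proof
  fix b :: real assume "b \<in> {0<..<1}"
  then have b: "0 < b" "b < 1" by auto
  let ?m = "real CARD('m)" and ?n = "real CARD('n)"
  obtain j0 where j0: "\<And>j. k $ j \<le> k $ j0"
  proof -
    have "Max (range (($) k)) \<in> range (($) k)" by (intro Max_in) auto
    then obtain j0 where "Max (range (($) k)) = k $ j0" by blast
    then show thesis using that[of j0] by (metis Max_ge finite finite_imageI rangeI)
  qed
  define \<kappa> where "\<kappa> = ?m * k $ j0"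
  have \<kappa>: "0 < \<kappa>" using assms(1) by (simp add: \<kappa>_def)
  obtain e K T0 where e: "0 < e" "e \<le> 1" and K: "0 < K" and
    dual: "\<And>T. T0 \<le> T \<Longrightarrow> \<exists>u \<in> int_lattice. e * real T powr (?m * k $ j0) < \<bar>u $ j0\<bar>
       \<and> (\<forall>j. \<bar>u $ j\<bar> \<le> K * real T powr (?m * k $ j))
       \<and> (\<forall>i. real T * dist_int ((transpose L *v u) $ i) \<le> 1)"
    using exists_dual_vector[OF assms] by metis
  obtain u where u: "\<And>T. T0 \<le> T \<Longrightarrow> u T \<in> int_lattice"
    and u_ge: "\<And>T. T0 \<le> T \<Longrightarrow> e * real T powr \<kappa> < \<bar>u T $ j0\<bar>"
    and u_le: "\<And>T j. T0 \<le> T \<Longrightarrow> \<bar>u T $ j\<bar> \<le> K * real T powr (?m * k $ j)"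
    and Lu: "\<And>T i. T0 \<le> T \<Longrightarrow> real T * dist_int ((transpose L *v u T) $ i) \<le> 1"
    using dual unfolding \<kappa>_def by metis
  have norm_ge: "e * real T powr \<kappa> \<le> norm (u T)" if "T0 \<le> T" for T
    using u_ge[OF that] component_le_norm_cart[of "u T" j0] by linarith
  have norm_le: "norm (u T) \<le> ?n * K * real T powr \<kappa>" if "T0 \<le> T" "1 \<le> T" for T
  proof -
    have "norm (u T) \<le> (\<Sum>j\<in>UNIV. \<bar>u T $ j\<bar>)" by (rule norm_le_l1_cart)
    also have "\<dots> \<le> (\<Sum>j\<in>(UNIV::'n set). K * real T powr \<kappa>)"
    proof (rule sum_mono)
      fix j
      have "real T powr (?m * k $ j) \<le> real T powr \<kappa>"
        using that j0[of j] by (intro powr_mono) (auto simp: \<kappa>_def)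
      then have "K * real T powr (?m * k $ j) \<le> K * real T powr \<kappa>" using K by simp
      with u_le[OF that(1), of j] show "\<bar>u T $ j\<bar> \<le> K * real T powr \<kappa>" by linarith
    qed
    finally show ?thesis by simp
  qed
  \<comment> \<open>Chosen so that \<open>\<Omega> powr \<kappa>\<close> is the factor by which
    Bob's radius shrinks over two turns.\<close>
  define \<Omega> where "\<Omega> = (1 / (b / 2) ^ 2) powr (1 / \<kappa>)"
  have "1 < 1 / (b / 2) ^ 2"
    using b power_strict_mono[of "b / 2" 1 2] by simp
  then have \<Omega>: "1 < \<Omega>" using \<kappa> unfolding \<Omega>_def by (intro gr_one_powr) auto
  \<comment> \<open>Starts the scales so that the upper bound
    \<open>?n * K * t r powr \<kappa>\<close> for the dual norm, times \<open>r\<close>, is 1/16,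
    safely below 1/8.\<close>
  define t where "t r = (1 / (16 * ?n * K * r)) powr (1 / \<kappa>)" for r
  have \<tau>_powr: "(t r * \<Omega> ^ p) powr \<kappa> * (r * (b / 2) ^ (2 * p)) = 1 / (16 * ?n * K)" if "0 < r" for r p
  proof -
    have "(\<Omega> ^ p) powr \<kappa> = (\<Omega> powr \<kappa>) ^ p"
      using \<Omega> by (induction p) (simp_all add: powr_mult)
    also have "\<Omega> powr \<kappa> = 1 / (b / 2) ^ 2" using \<kappa> b by (simp add: \<Omega>_def powr_powr)
    finally have "(\<Omega> ^ p) powr \<kappa> = 1 / (b / 2) ^ (2 * p)"
      by (simp add: power_mult power_divide)
    moreover have "t r powr \<kappa> = 1 / (16 * ?n * K * r)"
      using \<kappa> K that by (simp add: t_def powr_powr)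
    ultimately have "(t r * \<Omega> ^ p) powr \<kappa> = 1 / (16 * ?n * K * r) * (1 / (b / 2) ^ (2 * p))"
      using \<Omega> by (simp add: powr_mult t_def)
    then show ?thesis using that b K by simp
  qed
  define T where "T r p = nat \<lfloor>t r * \<Omega> ^ p\<rfloor>" for r p
  \<comment> \<open>In turns whose scale is too small for a dual vector the zero vector stands in;
    it meets the requirements of the strategy trivially.\<close>
  define W where "W r p = (if T0 \<le> T r p \<and> 1 \<le> T r p then u (T r p) else 0)" for r p
  \<comment> \<open>Collects the losses: \<open>e\<close> from the lower bound on the norm,
    \<open>b / 2\<close> from the radius one turn later, \<open>(1 / 2) powr \<kappa>\<close> from
    rounding the scale down.\<close>
  define g where "g = e * (b / 2) * (1 / 2) powr \<kappa> * (1 / (16 * ?n * K))"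
  have g: "0 < g" using e b K by (simp add: g_def)
  show "\<exists>\<sigma>. winning_strategy (1 / 2) b {\<alpha>. inhom_bad k L \<alpha>} \<sigma>"
  proof (rule winning_strategy_away[OF b, of W])
    fix r :: real and p assume r: "0 < r"
    show "norm (W r p) * (r * (b / 2) ^ (2 * p)) < 1 / 8"
    proof (cases "T0 \<le> T r p \<and> 1 \<le> T r p")
      case True
      have "0 < t r" using r K by (simp add: t_def)
      then have "0 < t r * \<Omega> ^ p" using \<Omega> by simp
      then have "real (T r p) \<le> t r * \<Omega> ^ p" unfolding T_def by linarith
      then have "real (T r p) powr \<kappa> \<le> (t r * \<Omega> ^ p) powr \<kappa>"
        using \<kappa> by (intro powr_mono2) auto
      then have "norm (u (T r p)) \<le> ?n * K * (t r * \<Omega> ^ p) powr \<kappa>"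
        using norm_le[of "T r p"] True K
        by (meson mult_left_mono mult_nonneg_nonneg less_imp_le of_nat_0_le_iff order_trans)
      then have "norm (u (T r p)) * (r * (b / 2) ^ (2 * p))
          \<le> ?n * K * (t r * \<Omega> ^ p) powr \<kappa> * (r * (b / 2) ^ (2 * p))"
        using r b by (intro mult_right_mono) auto
      also have "\<dots> = ?n * K * (1 / (16 * ?n * K))"
        unfolding \<tau>_powr[OF r, of p, symmetric] by (simp only: mult.assoc)
      also have "\<dots> < 1 / 8" using K by simp
      finally show ?thesis using True by (simp add: W_def)
    next
      case False
      then show ?thesis by (simp only: W_def if_False norm_zero)
    qed
  next
    fix r :: real and \<alpha>
    assume r: "0 < r"
      and \<alpha>: "\<And>p. norm (W r p) * (r * (b / 2) ^ Suc (2 * p)) \<le> dist_int (W r p \<bullet> \<alpha>)"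
    have t: "0 < t r" using r K by (simp add: t_def)
    \<comment> \<open>Three demands on the scale: after rounding down, which costs at most a factor
      2, it must still reach \<open>2 * ?m / g * Q\<close> and \<open>T0\<close>, and it must be at
      least 2 for that factor to suffice.\<close>
    define A where "A = 4 * ?m / g + 2 * real T0 + 2"
    show "\<alpha> \<in> {\<alpha>. inhom_bad k L \<alpha>}"
      unfolding mem_Collect_eq
    proof (rule inhom_badI[OF assms(1,2) g K])
      fix Q :: real assume Q: "1 \<le> Q"
      have A: "0 \<le> 4 * ?m / g" using g by simp
      then have "0 \<le> A * Q" using Q by (simp add: A_def)
      then obtain p where p: "A * Q \<le> t r * \<Omega> ^ p" "t r * \<Omega> ^ p \<le> t r + \<Omega> * (A * Q)"
        by (rule geometric_sequence_hits[OF t \<Omega>])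
      define \<tau> where "\<tau> = t r * \<Omega> ^ p"
      have "A * Q = 4 * ?m / g * Q + 2 * real T0 * Q + 2 * Q" by (simp add: A_def algebra_simps)
      moreover have "real T0 * 1 \<le> real T0 * Q" using Q by (intro mult_left_mono) auto
      moreover have "0 \<le> 4 * ?m / g * Q" using A Q by (intro mult_nonneg_nonneg) auto
      ultimately have \<tau>: "4 * ?m / g * Q \<le> \<tau>" "2 * real T0 \<le> \<tau>" "2 \<le> \<tau>"
        using p(1) Q unfolding \<tau>_def[symmetric] by linarith+
      have T: "real (T r p) \<le> \<tau>" "\<tau> / 2 \<le> real (T r p)"
        using \<tau>(3) unfolding T_def \<tau>_def[symmetric] by linarith+
      have Tp: "T0 \<le> T r p" "1 \<le> T r p" using T \<tau> by linarith+
      then have W: "W r p = u (T r p)" by (simp add: W_def)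
      have "g = e * (b / 2) * (1 / 2) powr \<kappa> * (\<tau> powr \<kappa> * (r * (b / 2) ^ (2 * p)))"
        unfolding g_def \<tau>_def \<tau>_powr[OF r] ..
      also have "\<dots> = e * (\<tau> / 2) powr \<kappa> * (r * (b / 2) ^ Suc (2 * p))"
        using powr_mult[of "1/2" \<tau> \<kappa>] \<tau>(3) by (simp add: mult_ac)
      also have "\<dots> \<le> e * real (T r p) powr \<kappa> * (r * (b / 2) ^ Suc (2 * p))"
        using T \<tau> \<kappa> e r b by (intro mult_right_mono mult_left_mono powr_mono2) auto
      also have "\<dots> \<le> norm (u (T r p)) * (r * (b / 2) ^ Suc (2 * p))"
        using r b by (intro mult_right_mono norm_ge Tp) auto
      also have "\<dots> \<le> dist_int (u (T r p) \<bullet> \<alpha>)" using \<alpha>[of p] W by simp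
      finally have g_le: "g \<le> dist_int (u (T r p) \<bullet> \<alpha>)" .
      \<comment> \<open>As \<open>Q \<ge> 1\<close>, the additive \<open>t r\<close> is absorbed
        into a multiple of \<open>Q\<close>; the resulting constant depends on Bob's first radius
        but not on \<open>Q\<close>.\<close>
      have "t r * 1 \<le> t r * Q" using t Q by (intro mult_left_mono) auto
      then have "real (T r p) \<le> (t r + \<Omega> * A) * Q"
        using T(1) p(2) by (simp add: \<tau>_def distrib_right mult.assoc)
      moreover have "2 * ?m / g * Q \<le> real (T r p)" using T(2) \<tau>(1) by simp
      ultimately show "\<exists>T u. 2 * ?m / g * Q \<le> T \<and> T \<le> (t r + \<Omega> * A) * Q \<and> u \<in> int_lattice
         \<and> (\<forall>j. \<bar>u $ j\<bar> \<le> K * T powr (?m * k $ j))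
         \<and> (\<forall>i. T * dist_int ((transpose L *v u) $ i) \<le> 1) \<and> g \<le> dist_int (u \<bullet> \<alpha>)"
        using g_le u[OF Tp(1)] u_le[OF Tp(1)] Lu[OF Tp(1)] by blast
    qed
  qed
qed

end
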